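(* For each $n$, let $p=p_n\ge2$, $s=s_n$, let $\beta^*\in\mathbb{R}^p$ have support $\mathcal{S}$ with at most $s$ elements, let $x_1,\dots,x_n\in\mathbb{R}^p$ be fixed vectors such that every column of the matrix $X_n\in\mathbb{R}^{n\times p}$ with $i$-th row $x_i$ has $\ell_2$-norm at most $\sqrt n$, and let $Y_i=\langle x_i,\beta^*\rangle+W_i$, where $W_1,\dots,W_n$ are independent zero-mean sub-Gaussian random variables with parameter $c>0$ (not depending on $n$). Let $$L_n(\beta)=\frac1n\sum_{i=1}^n\frac12\left(Y_i-\langle x_i,\beta\rangle\right)^2,\qquad \hat\beta_n:=\arg\min_{\beta\in\mathbb{R}^p}L_n(\beta)+\tau_n\|\beta\|_1,\quad \tau_n>0 .$$ Suppose that there are $\lambda_{\min}>0$ and $\alpha\in(0,1]$ (possibly depending on $n$, but bounded away from zero) such that for every $n$: (i) $[\nabla^2L_n(\beta^* )]_{\mathcal{S},\mathcal{S}}\ge\lambda_{\min}I$ in the positive-semidefinite order; (ii) $\left\|[\nabla^2L_n(\beta^* )]_{\mathcal{S}^c,\mathcal{S}}[\nabla^2L_n(\beta^* )]_{\mathcal{S},\mathcal{S}}^{-1}\right\|_\infty<1-\alpha$; (iii) $\min\{|(\beta^* )_k|:k\in\mathcal{S}\}>\frac{\alpha+4}{\lambda_{\min}}\sqrt s\,\tau_n$. If $s\log p\ll n$ and $\tau_n\gg(n^{-1}\log p)^{1/2}$, then $\hat\beta_n$ is sparsistent, i.e. $\lim_{n\to\infty}\mathsf{P}\{\mathrm{s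upp}\,\hat\beta_n\ne\mathrm{supp}\,\beta^*\}=0$.
   Context: A zero-mean real random variable $Z$ is sub-Gaussian with parameter $c>0$ if $\mathsf{E}\exp(tZ)\le\exp(c^2t^2/2)$ for all $t\in\mathbb{R}$. For positive sequences, $a_n\ll b_n$ (equivalently $b_n\gg a_n$) means $a_n/b_n\to0$ as $n\to\infty$. $p$, $s$, $\beta^*$, the $x_i$ and $\tau_n$ may all vary with $n$. $A_{\mathcal{S},\mathcal{S}}$, $A_{\mathcal{S}^c,\mathcal{S}}$ denote sub-matrices indexed by $\mathcal{S}$ and its complement $\mathcal{S}^c$ in $\{1,\dots,p\}$; for a matrix, $\|\cdot\|_\infty$ is the operator norm induced by the vector $\ell_\infty$-norm (maximum absolute row sum). Here $\nabla^2L_n=\frac1nX_n^TX_n$ is deterministic. *)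

theory Defs
  imports
    "HOL-Probability.Probability"
    "Jordan_Normal_Form.DL_Submatrix"
    "Jordan_Normal_Form.Gauss_Jordan_Elimination"
begin

text \<open>
  The dimensions vary with the sample size, so vectors and matrices are those of
  \<^theory>\<open>Jordan_Normal_Form.Matrix\<close>, with indices starting at 0; the notation \<open>$\<close> of
  HOL-Analysis would clash and is switched off.
\<close>

unbundle no vec_syntax

text \<open>\<open>Z\<close> is zero-mean and sub-Gaussian with parameter \<open>c\<close>.  Integrability of
  \<open>exp (t * Z)\<close> is explicit because the Bochner integral of a non-integrable function is 0.\<close>

definition subgaussian :: "'a measure \<Rightarrow> ('a \<Rightarrow> real) \<Rightarrow> real \<Rightarrow> bool" where
  "subgaussian M Z c \<longleftrightarrow>
     integrable M Z \<and> (LINT \<omega>|M. Z \<omega>) = 0 \<and>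
     (\<forall>t. integrable M (\<lambda>\<omega>. exp (t * Z \<omega>)) \<and>
          (LINT \<omega>|M. exp (t * Z \<omega>)) \<le> exp (c\<^sup>2 * t\<^sup>2 / 2))"

definition supp :: "real Matrix.vec \<Rightarrow> nat set" where
  "supp v = {k. k < dim_vec v \<and> v $ k \<noteq> 0}"

definition l1_norm :: "real Matrix.vec \<Rightarrow> real" where
  "l1_norm v = (\<Sum>k<dim_vec v. \<bar>v $ k\<bar>)"

text \<open>The operator norm induced by the vector maximum norm, as the maximal absolute row sum;
  the inserted 0 is the value for a matrix without rows.\<close>

definition linf_op_norm :: "real Matrix.mat \<Rightarrow> real" where
  "linf_op_norm A = Max (insert 0 ((\<lambda>i. \<Sum>j<dim_col A. \<bar>A $$ (i, j)\<bar>) ` {..<dim_row A}))"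

definition positive_semidefinite :: "real Matrix.mat \<Rightarrow> bool" where
  "positive_semidefinite A \<longleftrightarrow>
     square_mat A \<and> transpose_mat A = A \<and>
     (\<forall>v\<in>carrier_vec (dim_row A). 0 \<le> scalar_prod v (A *\<^sub>v v))"

definition psd_le :: "real Matrix.mat \<Rightarrow> real Matrix.mat \<Rightarrow> bool" where
  "psd_le A B \<longleftrightarrow> positive_semidefinite (B - A)"

definition partial_deriv :: "nat \<Rightarrow> (real Matrix.vec \<Rightarrow> real) \<Rightarrow> real Matrix.vec \<Rightarrow> real" where
  "partial_deriv k f v = deriv (\<lambda>t. f (v + t \<cdot>\<^sub>v unit_vec (dim_vec v) k)) 0"

definition hessian :: "(real Matrix.vec \<Rightarrow> real) \<Rightarrow> real Matrix.vec \<Rightarrow> real Matrix.mat" where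
  "hessian f v = Matrix.mat (dim_vec v) (dim_vec v)
     (\<lambda>(j, k). partial_deriv j (partial_deriv k f) v)"

text \<open>The loss \<open>L\<^sub>n\<close> for the design matrix \<open>X\<close> (whose rows are the covariate vectors) and
  the responses \<open>y 0, \<dots>, y (n - 1)\<close>.\<close>

definition lsq_loss :: "real Matrix.mat \<Rightarrow> (nat \<Rightarrow> real) \<Rightarrow> real Matrix.vec \<Rightarrow> real" where
  "lsq_loss X y \<beta> = 1 / real (dim_row X) *
     (\<Sum>i<dim_row X. 1 / 2 * (y i - scalar_prod (Matrix.row X i) \<beta>)\<^sup>2)"

lemma scalar_prod_shift:
  fixes X :: "real Matrix.mat"
  assumes "X \<in> carrier_mat n p" "b \<in> carrier_vec p" "i < n" "k < p"
  shows "scalar_prod (Matrix.row X i) (b + t \<cdot>\<^sub>v unit_vec p k)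
       = scalar_prod (Matrix.row X i) b + t * X $$ (i, k)"
proof -
  have r: "Matrix.row X i \<in> carrier_vec p" using assms by auto
  have "scalar_prod (Matrix.row X i) (b + t \<cdot>\<^sub>v unit_vec p k)
      = scalar_prod (Matrix.row X i) b + scalar_prod (Matrix.row X i) (t \<cdot>\<^sub>v unit_vec p k)"
    by (rule scalar_prod_add_distrib[OF r assms(2)]) auto
  also have "scalar_prod (Matrix.row X i) (t \<cdot>\<^sub>v unit_vec p k) = t * X $$ (i, k)"
    using assms(1,3,4) r
    by (simp add: scalar_prod_smult_distrib[OF r unit_vec_carrier])
  finally show ?thesis .
qed

lemma partial_deriv_lsq_loss:
  assumes X: "X \<in> carrier_mat n p" and b: "b \<in> carrier_vec p" and k: "k < p"
  shows "partial_deriv k (lsq_loss X y) b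
       = 1 / real n * (\<Sum>i<n. (scalar_prod (Matrix.row X i) b - y i) * X $$ (i, k))"
proof -
  have "lsq_loss X y (b + t \<cdot>\<^sub>v unit_vec (dim_vec b) k)
      = 1 / real n * (\<Sum>i<n. 1 / 2 * (y i - (scalar_prod (Matrix.row X i) b + t * X $$ (i, k)))\<^sup>2)"
    for t using X b k unfolding lsq_loss_def by (auto simp: scalar_prod_shift[OF X b])
  then have "((\<lambda>t. lsq_loss X y (b + t \<cdot>\<^sub>v unit_vec (dim_vec b) k)) has_real_derivative
      1 / real n * (\<Sum>i<n. (scalar_prod (Matrix.row X i) b - y i) * X $$ (i, k))) (at 0)"
    by (simp only:) (rule DERIV_cmult, rule DERIV_sum,
        auto intro!: derivative_eq_intros simp: field_simps)
  then show ?thesis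
    unfolding partial_deriv_def by (rule DERIV_imp_deriv)
qed

lemma hessian_lsq_loss:
  assumes X: "X \<in> carrier_mat n p" and b: "b \<in> carrier_vec p"
  shows "hessian (lsq_loss X y) b = (1 / real n) \<cdot>\<^sub>m (transpose_mat X * X)"
proof (rule eq_matI)
  fix j k assume "j < dim_row ((1 / real n) \<cdot>\<^sub>m (transpose_mat X * X))"
    and "k < dim_col ((1 / real n) \<cdot>\<^sub>m (transpose_mat X * X))"
  then have jk: "j < p" "k < p" using X by auto
  have "partial_deriv k (lsq_loss X y) (b + t \<cdot>\<^sub>v unit_vec (dim_vec b) j)
      = 1 / real n * (\<Sum>i<n. (scalar_prod (Matrix.row X i) b + t * X $$ (i, j) - y i) * X $$ (i, k))"
    for t
    using X b jk by (subst partial_deriv_lsq_loss[OF X]) (auto simp: scalar_prod_shift[OF X b])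
  then have "((\<lambda>t. partial_deriv k (lsq_loss X y) (b + t \<cdot>\<^sub>v unit_vec (dim_vec b) j))
      has_real_derivative 1 / real n * (\<Sum>i<n. X $$ (i, j) * X $$ (i, k))) (at 0)"
    by (simp only:) (rule DERIV_cmult, rule DERIV_sum, auto intro!: derivative_eq_intros)
  then have "partial_deriv j (partial_deriv k (lsq_loss X y)) b
      = 1 / real n * (\<Sum>i<n. X $$ (i, j) * X $$ (i, k))"
    unfolding partial_deriv_def[of j] by (rule DERIV_imp_deriv)
  then show "hessian (lsq_loss X y) b $$ (j, k)
      = ((1 / real n) \<cdot>\<^sub>m (transpose_mat X * X)) $$ (j, k)"
    using X b jk by (auto simp: hessian_def scalar_prod_def lessThan_atLeast0)
qed (use X b in \<open>auto simp: hessian_def\<close>)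

end

theory Submission
  imports Defs "Jordan_Normal_Form.Determinant"
begin

text \<open>
  Write \<open>H = X\<^sup>T X / n\<close> for the Hessian, \<open>S\<close> for the support of \<open>\<beta>star\<close>, \<open>T\<close> for its complement,
  \<open>\<Delta> = \<beta>hat - \<beta>star\<close> for the error and \<open>z = X\<^sup>T W / n\<close> for the noise seen by the columns of the design.
  The gradient of the loss at \<open>\<beta>hat\<close> is \<open>r = H \<Delta> - z\<close>, and optimality along each coordinate says
  that \<open>- r / \<tau>\<close> is a subgradient of the \<open>\<ell>\<^sub>1\<close>-norm at \<open>\<beta>hat\<close>:
  \<open>\<bar>r k\<bar> \<le> \<tau>\<close> and \<open>r k * \<beta>hat k = - \<tau> * \<bar>\<beta>hat k\<bar>\<close> (\<open>lasso_gradient_conditions\<close>).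

  The theorem separates into a deterministic and a probabilistic statement.  The deterministic one
  is \<open>lasso_support_recovery\<close>: if \<open>\<bar>z k\<bar> \<le> \<alpha> \<tau> / 2\<close> for all \<open>k\<close>, then every minimizer has support
  \<open>S\<close>.  Eliminating \<open>\<Delta>\<^sub>S\<close> from \<open>H \<Delta> = z + r\<close> leaves a system for \<open>\<Delta>\<^sub>T\<close> whose matrix, a Schur
  complement, is positive semidefinite, whereas the incoherence condition makes its right-hand side
  point strictly against \<open>\<Delta>\<^sub>T\<close>; hence \<open>\<Delta>\<^sub>T = 0\<close> (\<open>incoherence_forces_zero_off_support\<close>).  On \<open>S\<close> what
  remains is \<open>H\<^sub>S\<^sub>S \<Delta>\<^sub>S = z\<^sub>S + r\<^sub>S\<close>, and the eigenvalue bound makes \<open>\<Delta>\<^sub>S\<close> smaller than every nonzero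
  entry of \<open>\<beta>star\<close> (\<open>coercive_system_max_bound\<close>), so no entry of the support is lost.

  The probabilistic one is a union bound.  Each \<open>z k\<close> is a weighted sum of independent sub-Gaussian
  variables whose squared weights add up to at most \<open>1 / n\<close>, so \<open>\<bar>z k\<bar> \<ge> \<epsilon>\<close> has probability at most
  \<open>2 exp (- n \<epsilon>\<^sup>2 / (2 c\<^sup>2))\<close> (\<open>indep_subgaussian_sum_tail_abs\<close>).  For \<open>\<epsilon>\<close> proportional to \<open>\<tau>\<close>, the sum
  over the \<open>p\<close> columns tends to 0 because \<open>n \<tau>\<^sup>2\<close> dominates \<open>log p\<close>
  (\<open>union_bound_rate_tendsto_0\<close>).\<close>

section \<open>Coordinatewise optimality and the error system\<close>

text \<open>
  The restriction of the penalized loss to a coordinate line, minus its value at the minimizer,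
  has the form below, with \<open>r\<close> the partial derivative of the loss and \<open>b\<close> the coordinate.  If
  \<open>b \<noteq> 0\<close>, the function is differentiable at 0, and its derivative \<open>r + \<tau> * sgn b\<close> vanishes; if
  \<open>b = 0\<close>, its two one-sided derivatives \<open>\<plusminus>r + \<tau>\<close> are nonnegative.  So \<open>- r / \<tau>\<close> is a subgradient of
  the absolute value at \<open>b\<close>; the two conclusions are the form in which this is used.\<close>

lemma penalized_quadratic_stationarity:
  fixes r h b \<tau> :: real
  assumes min: "\<And>t. 0 \<le> t * r + t\<^sup>2 * h + \<tau> * (\<bar>b + t\<bar> - \<bar>b\<bar>)"
    and \<tau>: "0 \<le> \<tau>"
  shows "\<bar>r\<bar> \<le> \<tau>" and "r * b = - \<tau> * \<bar>b\<bar>"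
proof -
  have right: "0 \<le> r + \<tau>"
    if "\<And>t. t > 0 \<Longrightarrow> 0 \<le> t * r + t\<^sup>2 * h + \<tau> * t" for r :: real
  proof (rule tendsto_lowerbound)
    show "((\<lambda>t. r + t * h + \<tau>) \<longlongrightarrow> r + \<tau>) (at_right 0)"
      by (auto intro!: tendsto_eq_intros)
    have "0 \<le> r + t * h + \<tau>" if "t > 0" for t
    proof -
      have "0 \<le> t * (r + t * h + \<tau>)"
        using \<open>\<And>t. t > 0 \<Longrightarrow> 0 \<le> t * r + t\<^sup>2 * h + \<tau> * t\<close>[OF that]
        by (simp add: algebra_simps power2_eq_square)
      then show ?thesis using that by (simp add: zero_le_mult_iff)
    qed
    then show "\<forall>\<^sub>F t in at_right 0. 0 \<le> r + t * h + \<tau>"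
      by (simp add: eventually_at_right_less eventually_mono[OF eventually_at_right_less])
  qed simp
  have smooth: "r + \<tau> * sgn b = 0" if "b \<noteq> 0"
  proof -
    let ?f = "\<lambda>t. t * r + t\<^sup>2 * h + \<tau> * (sgn b * t)"
    have "DERIV ?f 0 :> r + \<tau> * sgn b"
      by (auto intro!: derivative_eq_intros)
    moreover have "\<forall>t. \<bar>0 - t\<bar> < \<bar>b\<bar> \<longrightarrow> ?f 0 \<le> ?f t"
    proof (intro allI impI)
      fix t assume "\<bar>0 - t\<bar> < \<bar>b\<bar>"
      then have "\<bar>b + t\<bar> - \<bar>b\<bar> = sgn b * t" by (auto simp: sgn_if abs_if split: if_splits)
      then show "?f 0 \<le> ?f t" using min[of t] by simp
    qed
    ultimately show ?thesis using DERIV_local_min[of ?f _ 0 "\<bar>b\<bar>"] that by simp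
  qed
  have "\<bar>r\<bar> \<le> \<tau> \<and> r * b = - \<tau> * \<bar>b\<bar>"
  proof (cases "b = 0")
    case True
    have "0 \<le> r + \<tau>"
    proof (rule right)
      fix t :: real assume "t > 0"
      then show "0 \<le> t * r + t\<^sup>2 * h + \<tau> * t" using min[of t] True by simp
    qed
    moreover have "0 \<le> - r + \<tau>"
    proof (rule right)
      fix t :: real assume "t > 0"
      then show "0 \<le> t * - r + t\<^sup>2 * h + \<tau> * t" using min[of "- t"] True by simp
    qed
    ultimately show ?thesis using True by auto
  next
    case False
    have r: "r = - \<tau> * sgn b" using smooth[OF False] by simp
    then show ?thesis using \<tau> False by (auto simp: sgn_if abs_if)
  qed
  then show "\<bar>r\<bar> \<le> \<tau>" and "r * b = - \<tau> * \<bar>b\<bar>" by auto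
qed

text \<open>
  This is the heart of the proof.  \<open>\<Delta>\<close> is the error of the minimizer, \<open>z\<close> the noise and \<open>r\<close> the
  gradient of the loss at the minimizer; \<open>C\<close> holds the coefficients of the regression of the
  columns off \<open>S\<close> on the columns in \<open>S\<close>.  Write \<open>T = V - S\<close>.

  The stationarity equation is paired with the vector \<open>v\<close> that agrees with \<open>\<Delta>\<close> on \<open>T\<close> and equals
  \<open>- C\<^sup>T \<Delta>\<^sub>T\<close> on \<open>S\<close>.  By the choice of \<open>C\<close>, \<open>H v\<close> vanishes on \<open>S\<close>, so that by symmetry
  \<open>v \<bullet> H \<Delta> = \<Delta> \<bullet> H v = v \<bullet> H v \<ge> 0\<close>; the last term is the quadratic form of the Schur complement.
  On the other side, \<open>v \<bullet> (z + r)\<close> contains \<open>- \<tau> * \<bar>\<Delta> m\<bar>\<close> for each \<open>m \<in> T\<close>, and all that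
  can compensate it is the noise \<open>\<alpha> \<tau> / 2\<close> at \<open>m\<close> and at most \<open>(1 - \<alpha>) (\<alpha> \<tau> / 2 + \<tau>)\<close> from \<open>S\<close>.
  The balance is \<open>- \<alpha>\<^sup>2 \<tau> / 2 * \<bar>\<Delta> m\<bar>\<close>, so every \<open>\<Delta> m\<close> has to vanish.\<close>

lemma incoherence_forces_zero_off_support:
  fixes H C :: "'i \<Rightarrow> 'i \<Rightarrow> real" and \<Delta> z r :: "'i \<Rightarrow> real"
  assumes V: "finite V" "S \<subseteq> V"
    and sym: "\<And>k l. k \<in> V \<Longrightarrow> l \<in> V \<Longrightarrow> H k l = H l k"
    and psd: "\<And>v. 0 \<le> (\<Sum>k\<in>V. v k * (\<Sum>l\<in>V. H k l * v l))"
    and stationary: "\<And>k. k \<in> V \<Longrightarrow> (\<Sum>l\<in>V. H k l * \<Delta> l) = z k + r k"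
    and C: "\<And>j k. j \<in> V - S \<Longrightarrow> k \<in> S \<Longrightarrow> (\<Sum>l\<in>S. C j l * H l k) = H j k"
    and incoherence: "\<And>j. j \<in> V - S \<Longrightarrow> (\<Sum>l\<in>S. \<bar>C j l\<bar>) \<le> 1 - \<alpha>"
    and noise: "\<And>k. k \<in> V \<Longrightarrow> \<bar>z k\<bar> \<le> \<alpha> * \<tau> / 2"
    and r_le: "\<And>k. k \<in> V \<Longrightarrow> \<bar>r k\<bar> \<le> \<tau>"
    and r_off: "\<And>j. j \<in> V - S \<Longrightarrow> r j * \<Delta> j = - \<tau> * \<bar>\<Delta> j\<bar>"
    and pos: "0 < \<tau>" "0 < \<alpha>"
    and j: "j \<in> V - S"
  shows "\<Delta> j = 0"
proof -
  define T where "T = V - S"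
  define v where "v k = (if k \<in> S then - (\<Sum>m\<in>T. \<Delta> m * C m k) else \<Delta> k)" for k
  have fin: "finite S" "finite T" using V finite_subset by (auto simp: T_def)
  have split: "(\<Sum>k\<in>V. f k) = (\<Sum>k\<in>S. f k) + (\<Sum>k\<in>T. f k)" for f :: "'i \<Rightarrow> real"
    unfolding T_def using V by (simp add: sum.subset_diff add.commute)
  have v_T: "k \<in> T \<Longrightarrow> v k = \<Delta> k" for k by (simp add: v_def T_def)
  have v_S: "k \<in> S \<Longrightarrow> v k = - (\<Sum>m\<in>T. \<Delta> m * C m k)" for k by (simp add: v_def)
  \<comment> \<open>The pairing with \<open>v\<close>, with \<open>\<Delta> m\<close> factored out; it serves both for the rows of \<open>H\<close> and for
    \<open>z + r\<close>.\<close>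
  have pair: "(\<Sum>k\<in>V. f k * v k) = (\<Sum>m\<in>T. \<Delta> m * (f m - (\<Sum>l\<in>S. C m l * f l)))"
    for f :: "'i \<Rightarrow> real"
  proof -
    have "(\<Sum>k\<in>S. f k * v k) = - (\<Sum>k\<in>S. \<Sum>m\<in>T. \<Delta> m * (C m k * f k))"
      by (simp add: v_S sum_distrib_left sum_negf mult_ac)
    also have "\<dots> = - (\<Sum>m\<in>T. \<Delta> m * (\<Sum>k\<in>S. C m k * f k))"
      by (subst sum.swap) (simp add: sum_distrib_left)
    finally show ?thesis
      by (simp add: split v_T right_diff_distrib sum_subtractf mult.commute)
  qed
  have Hv_S: "(\<Sum>l\<in>V. H k l * v l) = 0" if k: "k \<in> S" for k
  proof -
    have "H m k = H k m" if "m \<in> V" for m using sym that k V by blast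
    then have "H k m - (\<Sum>l\<in>S. C m l * H k l) = 0" if "m \<in> T" for m
      using C[of m k] k that V sym[of k] unfolding T_def
      by (smt (verit) DiffD1 subsetD sum.cong)
    then show ?thesis by (simp add: pair)
  qed
  have "0 \<le> (\<Sum>k\<in>V. v k * (\<Sum>l\<in>V. H k l * v l))" by (rule psd)
  also have "\<dots> = (\<Sum>k\<in>V. \<Delta> k * (\<Sum>l\<in>V. H k l * v l))"
    by (simp add: split[of "\<lambda>k. _ k * (\<Sum>l\<in>V. H k l * v l)"] Hv_S v_T)
  also have "\<dots> = (\<Sum>k\<in>V. \<Sum>l\<in>V. \<Delta> k * (H k l * v l))" by (simp add: sum_distrib_left)
  also have "\<dots> = (\<Sum>l\<in>V. \<Sum>k\<in>V. \<Delta> k * (H k l * v l))" by (rule sum.swap)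
  also have "\<dots> = (\<Sum>l\<in>V. (z l + r l) * v l)"
  proof (rule sum.cong)
    fix l assume l: "l \<in> V"
    have "(\<Sum>k\<in>V. \<Delta> k * (H k l * v l)) = (\<Sum>k\<in>V. H l k * \<Delta> k) * v l"
      unfolding sum_distrib_right by (rule sum.cong) (use sym l in \<open>auto simp: mult_ac\<close>)
    then show "(\<Sum>k\<in>V. \<Delta> k * (H k l * v l)) = (z l + r l) * v l" by (simp add: stationary l)
  qed simp
  also have "\<dots> = (\<Sum>m\<in>T. \<Delta> m * (z m + r m - (\<Sum>l\<in>S. C m l * (z l + r l))))" by (rule pair)
  also have "\<dots> \<le> (\<Sum>m\<in>T. - (\<alpha>\<^sup>2 * \<tau> / 2) * \<bar>\<Delta> m\<bar>)"
  proof (rule sum_mono)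
    fix m assume m: "m \<in> T"
    have "\<bar>\<Sum>l\<in>S. C m l * (z l + r l)\<bar> \<le> (\<Sum>l\<in>S. \<bar>C m l\<bar> * (\<alpha> * \<tau> / 2 + \<tau>))"
    proof (rule order_trans[OF sum_abs sum_mono])
      fix l assume "l \<in> S"
      then have "\<bar>z l + r l\<bar> \<le> \<alpha> * \<tau> / 2 + \<tau>" using noise[of l] r_le[of l] V by force
      then show "\<bar>C m l * (z l + r l)\<bar> \<le> \<bar>C m l\<bar> * (\<alpha> * \<tau> / 2 + \<tau>)"
        by (simp add: abs_mult mult_left_mono)
    qed
    also have "\<dots> \<le> (1 - \<alpha>) * (\<alpha> * \<tau> / 2 + \<tau>)"
      unfolding sum_distrib_right[symmetric]
      by (rule mult_right_mono) (use incoherence m pos in \<open>auto simp: T_def\<close>)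
    finally have C_le: "\<bar>\<Sum>l\<in>S. C m l * (z l + r l)\<bar> \<le> (1 - \<alpha>) * (\<alpha> * \<tau> / 2 + \<tau>)" .
    have z_le: "\<bar>z m\<bar> \<le> \<alpha> * \<tau> / 2" using noise[of m] m by (simp add: T_def)
    define q where "q = z m - (\<Sum>l\<in>S. C m l * (z l + r l))"
    have "\<bar>q\<bar> \<le> \<alpha> * \<tau> / 2 + (1 - \<alpha>) * (\<alpha> * \<tau> / 2 + \<tau>)"
      unfolding q_def by (rule order_trans[OF abs_triangle_ineq4 add_mono[OF z_le C_le]])
    also have "\<dots> = \<tau> - \<alpha>\<^sup>2 * \<tau> / 2" by (simp add: field_simps power2_eq_square)
    finally have "\<bar>\<Delta> m\<bar> * \<bar>q\<bar> \<le> \<bar>\<Delta> m\<bar> * (\<tau> - \<alpha>\<^sup>2 * \<tau> / 2)"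
      by (rule mult_left_mono) simp
    then have "\<Delta> m * q \<le> \<bar>\<Delta> m\<bar> * (\<tau> - \<alpha>\<^sup>2 * \<tau> / 2)"
      using abs_ge_self[of "\<Delta> m * q"] unfolding abs_mult by linarith
    moreover have "\<Delta> m * r m = - \<tau> * \<bar>\<Delta> m\<bar>" using r_off m by (simp add: T_def mult.commute)
    moreover have "\<Delta> m * (z m + r m - (\<Sum>l\<in>S. C m l * (z l + r l))) = \<Delta> m * q + \<Delta> m * r m"
      by (simp add: q_def algebra_simps)
    ultimately show "\<Delta> m * (z m + r m - (\<Sum>l\<in>S. C m l * (z l + r l))) \<le> - (\<alpha>\<^sup>2 * \<tau> / 2) * \<bar>\<Delta> m\<bar>"
      by (simp add: algebra_simps)
  qed
  finally have "\<alpha>\<^sup>2 * \<tau> / 2 * (\<Sum>m\<in>T. \<bar>\<Delta> m\<bar>) \<le> 0" by (simp add: sum_negf sum_distrib_left)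
  then have "(\<Sum>m\<in>T. \<bar>\<Delta> m\<bar>) \<le> 0"
    using pos by (simp add: mult_le_0_iff)
  then have "(\<Sum>m\<in>T. \<bar>\<Delta> m\<bar>) = 0" by (simp add: sum_nonneg antisym)
  then show ?thesis using j fin by (simp add: sum_nonneg_eq_0_iff T_def)
qed

text \<open>
  Pairing the equation with \<open>\<Delta>\<close> itself gives \<open>\<mu> * N\<^sup>2 \<le> B * (\<Sum>k\<in>S. \<bar>\<Delta> k\<bar>)\<close> for the Euclidean norm \<open>N\<close>
  of \<open>\<Delta>\<close>, and the last sum is at most \<open>sqrt (card S) * N\<close> by the Cauchy-Schwarz inequality.\<close>

lemma coercive_system_max_bound:
  fixes H :: "'i \<Rightarrow> 'i \<Rightarrow> real" and \<Delta> e :: "'i \<Rightarrow> real"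
  assumes S: "finite S" "k \<in> S"
    and coercive: "\<mu> * (\<Sum>k\<in>S. (\<Delta> k)\<^sup>2) \<le> (\<Sum>k\<in>S. \<Delta> k * (\<Sum>l\<in>S. H k l * \<Delta> l))"
    and eq: "\<And>k. k \<in> S \<Longrightarrow> (\<Sum>l\<in>S. H k l * \<Delta> l) = e k"
    and e: "\<And>k. k \<in> S \<Longrightarrow> \<bar>e k\<bar> \<le> B"
    and \<mu>: "0 < \<mu>"
  shows "\<bar>\<Delta> k\<bar> \<le> B * sqrt (card S) / \<mu>"
proof -
  define N where "N = L2_set \<Delta> S"
  have "0 \<le> B" using e[OF S(2)] by linarith
  have "0 \<le> N" by (simp add: N_def L2_set_nonneg)
  have "\<mu> * N\<^sup>2 \<le> (\<Sum>k\<in>S. \<Delta> k * e k)"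
    using coercive eq by (simp add: N_def L2_set_def sum_nonneg)
  also have "\<dots> \<le> (\<Sum>k\<in>S. B * (\<bar>1\<bar> * \<bar>\<Delta> k\<bar>))"
  proof (rule sum_mono)
    fix k assume "k \<in> S"
    then have "\<bar>\<Delta> k * e k\<bar> \<le> \<bar>\<Delta> k\<bar> * B" using e by (simp add: abs_mult mult_left_mono)
    then show "\<Delta> k * e k \<le> B * (\<bar>1\<bar> * \<bar>\<Delta> k\<bar>)" by (simp add: mult.commute)
  qed
  also have "\<dots> \<le> B * (sqrt (card S) * N)"
    using mult_left_mono[OF L2_set_mult_ineq[of "\<lambda>_. 1" \<Delta> S] \<open>0 \<le> B\<close>]
    by (simp add: sum_distrib_left N_def L2_set_def)
  finally have "N * (\<mu> * N) \<le> N * (B * sqrt (card S))"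
    by (simp add: power2_eq_square mult_ac)
  then have "\<mu> * N \<le> B * sqrt (card S)"
    using \<open>0 \<le> N\<close> \<open>0 \<le> B\<close> by (cases "N = 0") auto
  moreover have "\<bar>\<Delta> k\<bar> \<le> N"
    using member_le_L2_set[OF S, of "\<lambda>k. \<bar>\<Delta> k\<bar>"] by (simp add: N_def L2_set_def)
  ultimately have "\<mu> * \<bar>\<Delta> k\<bar> \<le> B * sqrt (card S)"
    using \<mu> by (meson mult_le_cancel_left_pos order_trans)
  then show ?thesis using \<mu> by (simp add: field_simps)
qed

section \<open>Submatrices in terms of the original indices\<close>

lemma bij_betw_pick:
  assumes "finite S"
  shows "bij_betw (pick S) {..<card S} S"
proof -
  have inj: "inj_on (pick S) {..<card S}"
    by (rule inj_onI) (metis lessThan_iff linorder_neqE_nat pick_mono_le less_irrefl)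
  moreover have "pick S ` {..<card S} = S"
    by (rule card_subset_eq) (use assms pick_in_set_le inj in \<open>auto simp: card_image\<close>)
  ultimately show ?thesis by (simp add: bij_betw_def)
qed

lemma submatrix_bounded_index:
  assumes "A \<in> carrier_mat n m" "I \<subseteq> {..<n}" "J \<subseteq> {..<m}"
  shows "submatrix A I J \<in> carrier_mat (card I) (card J)"
    and "i < card I \<Longrightarrow> j < card J \<Longrightarrow> submatrix A I J $$ (i, j) = A $$ (pick I i, pick J j)"
proof -
  have I: "{i. i < dim_row A \<and> i \<in> I} = I" and J: "{j. j < dim_col A \<and> j \<in> J} = J"
    using assms by auto
  show "submatrix A I J \<in> carrier_mat (card I) (card J)"
    by (rule carrier_matI) (simp_all only: dim_submatrix I J)
  show "submatrix A I J $$ (i, j) = A $$ (pick I i, pick J j)" if "i < card I" "j < card J"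
    by (rule submatrix_index) (simp_all only: I J that)
qed

text \<open>
  The finite sums in which the arguments above are stated are obtained from the matrix
  hypotheses here and in \<open>submatrix_coercive\<close>.\<close>

lemma psd_le_scaled_one_imp_coercive:
  assumes A: "A \<in> carrier_mat m m" and psd: "psd_le (\<mu> \<cdot>\<^sub>m 1\<^sub>m m) A"
  shows "\<mu> * (\<Sum>i<m. (u i)\<^sup>2) \<le> (\<Sum>i<m. u i * (\<Sum>j<m. A $$ (i, j) * u j))"
proof -
  have "0 \<le> scalar_prod (Matrix.vec m u) ((A - \<mu> \<cdot>\<^sub>m 1\<^sub>m m) *\<^sub>v Matrix.vec m u)"
    using psd A unfolding psd_le_def positive_semidefinite_def by auto
  also have "\<dots> = (\<Sum>i<m. u i * (\<Sum>j<m. (A $$ (i, j) - (if i = j then \<mu> else 0)) * u j))"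
    using A by (auto simp: scalar_prod_def lessThan_atLeast0 intro!: sum.cong)
  also have "\<dots> = (\<Sum>i<m. u i * (\<Sum>j<m. A $$ (i, j) * u j) - \<mu> * (u i)\<^sup>2)"
    by (rule sum.cong) (auto simp: left_diff_distrib sum_subtractf if_distrib[of "\<lambda>x. x * _"]
        right_diff_distrib power2_eq_square cong: if_cong)
  finally show ?thesis by (simp add: sum_subtractf sum_distrib_left)
qed

text \<open>
  \<^const>\<open>mat_inverse\<close> returns an option; a coercive matrix has trivial kernel, so the option is not
  \<open>None\<close> and \<^const>\<open>the\<close> yields a true inverse.\<close>

lemma coercive_mat_inverse:
  assumes A: "A \<in> carrier_mat m m" and psd: "psd_le (\<mu> \<cdot>\<^sub>m 1\<^sub>m m) A" and \<mu>: "0 < \<mu>"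
  shows "the (mat_inverse A) * A = 1\<^sub>m m" and "the (mat_inverse A) \<in> carrier_mat m m"
proof -
  have "Determinant.det A \<noteq> 0"
  proof
    assume "Determinant.det A = 0"
    then obtain v where v: "v \<in> carrier_vec m" "v \<noteq> 0\<^sub>v m" "A *\<^sub>v v = 0\<^sub>v m"
      using det_0_iff_vec_prod_zero_field[OF A] by auto
    have "(\<Sum>j<m. A $$ (i, j) * v $ j) = 0" if "i < m" for i
      using arg_cong[OF v(3), of "\<lambda>w. w $ i"] that A v(1)
      by (simp add: scalar_prod_def lessThan_atLeast0)
    then have "\<mu> * (\<Sum>i<m. (v $ i)\<^sup>2) \<le> 0"
      using psd_le_scaled_one_imp_coercive[OF A psd, of "\<lambda>i. v $ i"] by simp
    then have "(\<Sum>i<m. (v $ i)\<^sup>2) = 0" using \<mu> by (simp add: mult_le_0_iff sum_nonneg antisym)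
    then have "\<forall>i<m. v $ i = 0" by (simp add: sum_nonneg_eq_0_iff)
    then show False using v by auto
  qed
  then have "mat_inverse A \<noteq> None"
    using mat_inverse(1)[OF A, of "()"] det_non_zero_imp_unit[OF A, of "()"] by blast
  then show "the (mat_inverse A) * A = 1\<^sub>m m" "the (mat_inverse A) \<in> carrier_mat m m"
    using mat_inverse(2)[OF A] by auto
qed

lemma linf_op_norm_row_sum:
  assumes "linf_op_norm A < b" "i < dim_row A"
  shows "(\<Sum>j<dim_col A. \<bar>A $$ (i, j)\<bar>) < b"
proof -
  let ?R = "insert 0 ((\<lambda>i. \<Sum>j<dim_col A. \<bar>A $$ (i, j)\<bar>) ` {..<dim_row A})"
  have "(\<Sum>j<dim_col A. \<bar>A $$ (i, j)\<bar>) \<le> Max ?R"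
    by (rule Max_ge) (use assms(2) in auto)
  then show ?thesis using assms(1) unfolding linf_op_norm_def by (rule le_less_trans)
qed

text \<open>
  This restates the incoherence condition without an inverse: \<open>C = H\<^sub>T\<^sub>S H\<^sub>S\<^sub>S\<inverse>\<close> is characterized by
  \<open>C H\<^sub>S\<^sub>S = H\<^sub>T\<^sub>S\<close>, and its entries are indexed by the original indices instead of by
  positions within \<open>T\<close> and \<open>S\<close>.\<close>

lemma incoherence_regression_coefficients:
  assumes H: "H \<in> carrier_mat p p" and ST: "S \<subseteq> {..<p}" "T \<subseteq> {..<p}"
    and psd: "psd_le (\<mu> \<cdot>\<^sub>m 1\<^sub>m (card S)) (submatrix H S S)" and \<mu>: "0 < \<mu>"
    and norm: "linf_op_norm (submatrix H T S * the (mat_inverse (submatrix H S S))) < b"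
  obtains C where "\<And>j. j \<in> T \<Longrightarrow> (\<Sum>l\<in>S. \<bar>C j l\<bar>) < b"
    and "\<And>j k. j \<in> T \<Longrightarrow> k \<in> S \<Longrightarrow> (\<Sum>l\<in>S. C j l * H $$ (l, k)) = H $$ (j, k)"
proof -
  define A B where "A = submatrix H S S" and "B = submatrix H T S"
  define N where "N = B * the (mat_inverse A)"
  note SS = submatrix_bounded_index[OF H ST(1) ST(1), folded A_def]
  note TS = submatrix_bounded_index[OF H ST(2) ST(1), folded B_def]
  note inv = coercive_mat_inverse[OF SS(1) psd[folded A_def] \<mu>]
  have N: "N \<in> carrier_mat (card T) (card S)" using TS(1) inv(2) by (simp add: N_def)
  have NA: "N * A = B"
    unfolding N_def using assoc_mult_mat[OF TS(1) inv(2) SS(1)] inv(1) TS(1) by simp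
  have fin: "finite S" "finite T" using ST finite_subset by auto
  note bij = bij_betw_pick[OF fin(1)] bij_betw_pick[OF fin(2)]
  define rank where "rank I = inv_into {..<card I} (pick I)" for I
  define C where "C j l = N $$ (rank T j, rank S l)" for j l
  have rank_S: "rank S (pick S i) = i" if "i < card S" for i
    using bij(1) that by (simp add: rank_def bij_betw_def)
  have rank_T: "rank T (pick T i) = i" if "i < card T" for i
    using bij(2) that by (simp add: rank_def bij_betw_def)
  have sum_S: "(\<Sum>l\<in>S. f l) = (\<Sum>q<card S. f (pick S q))" for f :: "nat \<Rightarrow> real"
    by (rule sum.reindex_bij_betw[OF bij(1), symmetric])
  show thesis
  proof (rule that)
    fix j assume "j \<in> T"
    then obtain i where i: "i < card T" "j = pick T i"
      using bij(2) by (auto simp: bij_betw_def)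
    have "(\<Sum>q<card S. \<bar>N $$ (i, q)\<bar>) < b"
      using linf_op_norm_row_sum[OF norm[folded A_def B_def N_def], of i] i(1) N by simp
    then show "(\<Sum>l\<in>S. \<bar>C j l\<bar>) < b" by (simp add: sum_S C_def i rank_S rank_T)
    fix k assume "k \<in> S"
    then obtain m where m: "m < card S" "k = pick S m"
      using bij(1) by (auto simp: bij_betw_def)
    have "(\<Sum>l\<in>S. C j l * H $$ (l, k)) = (\<Sum>q<card S. N $$ (i, q) * A $$ (q, m))"
      by (simp add: sum_S C_def i m rank_S rank_T SS(2))
    also have "\<dots> = (N * A) $$ (i, m)"
      using N SS(1) i m by (simp add: scalar_prod_def lessThan_atLeast0)
    also have "\<dots> = H $$ (j, k)" using NA TS(2) i m by simp
    finally show "(\<Sum>l\<in>S. C j l * H $$ (l, k)) = H $$ (j, k)" .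
  qed
qed

lemma submatrix_coercive:
  assumes H: "H \<in> carrier_mat p p" and S: "S \<subseteq> {..<p}"
    and psd: "psd_le (\<mu> \<cdot>\<^sub>m 1\<^sub>m (card S)) (submatrix H S S)"
  shows "\<mu> * (\<Sum>k\<in>S. (u k)\<^sup>2) \<le> (\<Sum>k\<in>S. u k * (\<Sum>l\<in>S. H $$ (k, l) * u l))"
proof -
  note SS = submatrix_bounded_index[OF H S S]
  have sum_S: "(\<Sum>l\<in>S. f l) = (\<Sum>q<card S. f (pick S q))" for f :: "nat \<Rightarrow> real"
    by (rule sum.reindex_bij_betw[OF bij_betw_pick, symmetric]) (simp add: finite_subset[OF S])
  show ?thesis
    using psd_le_scaled_one_imp_coercive[OF SS(1) psd, of "\<lambda>q. u (pick S q)"]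
    by (simp add: sum_S SS(2))
qed

section \<open>Recovery of the support by the lasso\<close>

lemma lsq_loss_shift:
  assumes X: "X \<in> carrier_mat n p" and b: "b \<in> carrier_vec p" and k: "k < p"
  shows "lsq_loss X y (b + t \<cdot>\<^sub>v unit_vec p k)
       = lsq_loss X y b + t * partial_deriv k (lsq_loss X y) b
         + t\<^sup>2 * (1 / real n * (\<Sum>i<n. (X $$ (i, k))\<^sup>2 / 2))"
proof -
  let ?s = "\<lambda>i. scalar_prod (Matrix.row X i) b"
  have "lsq_loss X y (b + t \<cdot>\<^sub>v unit_vec p k)
      = 1 / real n * (\<Sum>i<n. 1 / 2 * (y i - (?s i + t * X $$ (i, k)))\<^sup>2)"
    using X b k unfolding lsq_loss_def by (auto simp: scalar_prod_shift[OF X b])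
  also have "(\<Sum>i<n. 1 / 2 * (y i - (?s i + t * X $$ (i, k)))\<^sup>2)
      = (\<Sum>i<n. 1 / 2 * (y i - ?s i)\<^sup>2 + t * ((?s i - y i) * X $$ (i, k)) + t\<^sup>2 * ((X $$ (i, k))\<^sup>2 / 2))"
    by (rule sum.cong) (auto simp: field_simps power2_eq_square)
  also have "\<dots> = (\<Sum>i<n. 1 / 2 * (y i - ?s i)\<^sup>2) + t * (\<Sum>i<n. (?s i - y i) * X $$ (i, k))
      + t\<^sup>2 * (\<Sum>i<n. (X $$ (i, k))\<^sup>2 / 2)"
    by (simp only: sum.distrib sum_distrib_left)
  finally show ?thesis
    using X unfolding partial_deriv_lsq_loss[OF X b k] by (simp add: lsq_loss_def algebra_simps)
qed

lemma l1_norm_shift: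
  assumes b: "b \<in> carrier_vec p" and k: "k < p"
  shows "l1_norm (b + t \<cdot>\<^sub>v unit_vec p k) = l1_norm b + (\<bar>b $ k + t\<bar> - \<bar>b $ k\<bar>)"
proof -
  have "l1_norm (b + t \<cdot>\<^sub>v unit_vec p k)
      = (\<Sum>l<p. \<bar>b $ l\<bar> + (if l = k then \<bar>b $ k + t\<bar> - \<bar>b $ k\<bar> else 0))"
    using b k unfolding l1_norm_def by (auto intro!: sum.cong)
  then show ?thesis using b k by (simp add: l1_norm_def sum.distrib)
qed

lemma lasso_gradient_conditions:
  assumes X: "X \<in> carrier_mat n p" and k: "k < p" and \<tau>: "0 \<le> \<tau>"
    and min: "is_arg_min (\<lambda>\<beta>. lsq_loss X y \<beta> + \<tau> * l1_norm \<beta>) (\<lambda>\<beta>. \<beta> \<in> carrier_vec p) b"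
  defines "r \<equiv> partial_deriv k (lsq_loss X y) b"
  shows "\<bar>r\<bar> \<le> \<tau>" and "r * b $ k = - \<tau> * \<bar>b $ k\<bar>"
proof -
  have b: "b \<in> carrier_vec p" using min by (simp add: is_arg_min_def)
  have "0 \<le> t * r + t\<^sup>2 * (1 / real n * (\<Sum>i<n. (X $$ (i, k))\<^sup>2 / 2)) + \<tau> * (\<bar>b $ k + t\<bar> - \<bar>b $ k\<bar>)" for t
  proof -
    have "b + t \<cdot>\<^sub>v unit_vec p k \<in> carrier_vec p" using b by simp
    then have "lsq_loss X y b + \<tau> * l1_norm b
        \<le> lsq_loss X y (b + t \<cdot>\<^sub>v unit_vec p k) + \<tau> * l1_norm (b + t \<cdot>\<^sub>v unit_vec p k)"
      using min unfolding is_arg_min_def by (meson not_less)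
    then show ?thesis
      unfolding lsq_loss_shift[OF X b k] l1_norm_shift[OF b k] r_def by (simp add: distrib_left)
  qed
  from penalized_quadratic_stationarity[OF this \<tau>]
  show "\<bar>r\<bar> \<le> \<tau>" and "r * b $ k = - \<tau> * \<bar>b $ k\<bar>" by auto
qed

text \<open>
  All randomness is in the hypothesis on the noise: once the columns of the design are almost
  uncorrelated with the noise, every minimizer has the right support.  The first half,
  \<open>incoherence_forces_zero_off_support\<close>, works with the optimality conditions of an arbitrary minimizer
  and so avoids the usual construction of a minimizer supported in \<open>S\<close> and its uniqueness.
  After the coordinates off \<open>S\<close> are known to vanish, the stationarity equation is a coercive system on
  \<open>S\<close> whose right-hand side has entries of modulus at most \<open>\<alpha> \<tau> / 2\<close> (noise) plus \<open>\<tau>\<close> (gradient); this is the origin of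
  the threshold for the signal, below which a coordinate might be shrunk to 0.\<close>

lemma lasso_support_recovery:
  fixes X :: "real Matrix.mat" and w :: "nat \<Rightarrow> real"
  assumes X: "X \<in> carrier_mat n p" and bs: "bs \<in> carrier_vec p"
    and y: "\<And>i. i < n \<Longrightarrow> y i = scalar_prod (Matrix.row X i) bs + w i"
    and min: "is_arg_min (\<lambda>\<beta>. lsq_loss X y \<beta> + \<tau> * l1_norm \<beta>) (\<lambda>\<beta>. \<beta> \<in> carrier_vec p) b"
    and pos: "0 < \<tau>" "0 < \<alpha>" "0 < \<mu>"
  defines "H \<equiv> hessian (lsq_loss X y) bs" and "S \<equiv> supp bs"
  assumes psd: "psd_le (\<mu> \<cdot>\<^sub>m 1\<^sub>m (card S)) (submatrix H S S)"
    and incoherence: "linf_op_norm (submatrix H ({..<p} - S) S * the (mat_inverse (submatrix H S S)))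
        < 1 - \<alpha>"
    and signal: "\<And>k. k \<in> S \<Longrightarrow> \<bar>bs $ k\<bar> > (1 + \<alpha> / 2) * \<tau> * sqrt (card S) / \<mu>"
    and noise: "\<And>k. k < p \<Longrightarrow> \<bar>1 / real n * (\<Sum>i<n. X $$ (i, k) * w i)\<bar> \<le> \<alpha> * \<tau> / 2"
  shows "supp b = supp bs"
proof -
  have b: "b \<in> carrier_vec p" using min by (simp add: is_arg_min_def)
  have H_eq: "H = (1 / real n) \<cdot>\<^sub>m (transpose_mat X * X)"
    unfolding H_def by (rule hessian_lsq_loss[OF X bs])
  have H: "H \<in> carrier_mat p p" using X by (simp add: H_eq)
  have H_entry: "H $$ (j, k) = 1 / real n * (\<Sum>i<n. X $$ (i, j) * X $$ (i, k))"
    if "j < p" "k < p" for j k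
    using X that by (simp add: H_eq scalar_prod_def lessThan_atLeast0)
  have S: "S \<subseteq> {..<p}" using bs by (auto simp: S_def supp_def)
  then have finS: "finite S" by (rule finite_subset) simp
  have sym: "H $$ (k, l) = H $$ (l, k)" if "k < p" "l < p" for k l
    using that by (simp add: H_entry mult.commute)
  define \<Delta> where "\<Delta> k = b $ k - bs $ k" for k
  define z where "z k = 1 / real n * (\<Sum>i<n. X $$ (i, k) * w i)" for k
  define r where "r k = partial_deriv k (lsq_loss X y) b" for k
  have H_mult: "(\<Sum>l<p. H $$ (k, l) * v l) = 1 / real n * (\<Sum>i<n. X $$ (i, k) * (\<Sum>l<p. X $$ (i, l) * v l))"
    if "k < p" for k and v :: "nat \<Rightarrow> real"
  proof -
    have "(\<Sum>l<p. H $$ (k, l) * v l)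
        = (\<Sum>l<p. \<Sum>i<n. 1 / real n * (X $$ (i, k) * (X $$ (i, l) * v l)))"
      using that by (simp add: H_entry sum_distrib_left sum_distrib_right mult_ac)
    also have "\<dots> = (\<Sum>i<n. \<Sum>l<p. 1 / real n * (X $$ (i, k) * (X $$ (i, l) * v l)))"
      by (rule sum.swap)
    finally show ?thesis by (simp only: sum_distrib_left)
  qed
  have psd_H: "0 \<le> (\<Sum>k<p. v k * (\<Sum>l<p. H $$ (k, l) * v l))" for v
  proof -
    define q where "q i = (\<Sum>l<p. X $$ (i, l) * v l)" for i
    have "(\<Sum>k<p. v k * (\<Sum>l<p. H $$ (k, l) * v l))
        = (\<Sum>k<p. \<Sum>i<n. 1 / real n * (X $$ (i, k) * v k * q i))"
    proof (rule sum.cong)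
      fix k assume "k \<in> {..<p}"
      then have "k < p" by simp
      show "v k * (\<Sum>l<p. H $$ (k, l) * v l) = (\<Sum>i<n. 1 / real n * (X $$ (i, k) * v k * q i))"
        unfolding H_mult[OF \<open>k < p\<close>] q_def[symmetric] by (simp add: sum_distrib_left mult_ac)
    qed simp
    also have "\<dots> = (\<Sum>i<n. \<Sum>k<p. 1 / real n * (X $$ (i, k) * v k * q i))"
      by (rule sum.swap)
    also have "\<dots> = (\<Sum>i<n. 1 / real n * (q i)\<^sup>2)"
      by (simp only: sum_distrib_left[symmetric] sum_distrib_right[symmetric] power2_eq_square q_def)
    also have "\<dots> \<ge> 0" by (rule sum_nonneg) simp
    finally show ?thesis .
  qed
  have stationary: "(\<Sum>l<p. H $$ (k, l) * \<Delta> l) = z k + r k" if "k < p" for k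
  proof -
    have fit: "(\<Sum>l<p. X $$ (i, l) * \<Delta> l)
        = w i + (scalar_prod (Matrix.row X i) b - y i)" if "i < n" for i
    proof -
      have dot: "scalar_prod (Matrix.row X i) v = (\<Sum>l<p. X $$ (i, l) * v $ l)"
        if "v \<in> carrier_vec p" for v
        using X \<open>i < n\<close> that by (simp add: scalar_prod_def lessThan_atLeast0)
      show ?thesis
        by (simp add: y[OF that] dot[OF b] dot[OF bs] \<Delta>_def right_diff_distrib sum_subtractf)
    qed
    have "(\<Sum>i<n. X $$ (i, k) * (\<Sum>l<p. X $$ (i, l) * \<Delta> l))
        = (\<Sum>i<n. X $$ (i, k) * w i) + (\<Sum>i<n. (scalar_prod (Matrix.row X i) b - y i) * X $$ (i, k))"
      unfolding sum.distrib[symmetric]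
    proof (rule sum.cong)
      fix i assume "i \<in> {..<n}"
      then have "i < n" by simp
      show "X $$ (i, k) * (\<Sum>l<p. X $$ (i, l) * \<Delta> l)
          = X $$ (i, k) * w i + (scalar_prod (Matrix.row X i) b - y i) * X $$ (i, k)"
        unfolding fit[OF \<open>i < n\<close>] by (simp add: algebra_simps)
    qed simp
    then show ?thesis
      unfolding H_mult[OF that] z_def r_def partial_deriv_lsq_loss[OF X b that]
      by (simp only: distrib_left)
  qed
  \<comment> \<open>The gradient conditions give the sign of \<open>r j * b j\<close>; off \<open>S\<close> the entries of \<open>b\<close> and \<open>\<Delta>\<close> agree.\<close>
  have r_le: "\<bar>r k\<bar> \<le> \<tau>" and r_sgn: "r k * b $ k = - \<tau> * \<bar>b $ k\<bar>" if "k < p" for k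
    using lasso_gradient_conditions[OF X that _ min] pos by (auto simp: r_def)
  have off: "bs $ j = 0" if "j \<in> {..<p} - S" for j
    using that bs by (auto simp: S_def supp_def)
  obtain C where C: "\<And>j. j \<in> {..<p} - S \<Longrightarrow> (\<Sum>l\<in>S. \<bar>C j l\<bar>) < 1 - \<alpha>"
    "\<And>j k. j \<in> {..<p} - S \<Longrightarrow> k \<in> S \<Longrightarrow> (\<Sum>l\<in>S. C j l * H $$ (l, k)) = H $$ (j, k)"
    using incoherence_regression_coefficients[OF H S _ psd pos(3) incoherence] by auto
  have zero: "\<Delta> j = 0" if "j \<in> {..<p} - S" for j
  proof (rule incoherence_forces_zero_off_support[where V = "{..<p}" and S = S and C = C
        and H = "\<lambda>k l. H $$ (k, l)" and z = z and r = r and \<alpha> = \<alpha> and \<tau> = \<tau>])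
    show "r j * \<Delta> j = - \<tau> * \<bar>\<Delta> j\<bar>" if "j \<in> {..<p} - S" for j
      using r_sgn[of j] off[OF that] that by (simp add: \<Delta>_def)
    show "\<bar>z k\<bar> \<le> \<alpha> * \<tau> / 2" if "k \<in> {..<p}" for k using noise that by (simp add: z_def)
    show "(\<Sum>l\<in>S. \<bar>C j l\<bar>) \<le> 1 - \<alpha>" if "j \<in> {..<p} - S" for j using C(1)[OF that] by simp
  qed (use S sym psd_H stationary C(2) r_le pos that in auto)
  have restrict: "(\<Sum>l\<in>S. H $$ (k, l) * \<Delta> l) = z k + r k" if "k \<in> S" for k
  proof -
    have "(\<Sum>l\<in>S. H $$ (k, l) * \<Delta> l) = (\<Sum>l<p. H $$ (k, l) * \<Delta> l)"
      by (rule sum.mono_neutral_left) (use S zero in auto)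
    then show ?thesis using stationary that S by auto
  qed
  have close: "\<bar>\<Delta> k\<bar> \<le> (1 + \<alpha> / 2) * \<tau> * sqrt (card S) / \<mu>" if "k \<in> S" for k
  proof (rule coercive_system_max_bound[OF finS that submatrix_coercive[OF H S psd] restrict _ pos(3)])
    fix k assume "k \<in> S"
    then have "k < p" using S by auto
    have "\<bar>z k + r k\<bar> \<le> \<alpha> * \<tau> / 2 + \<tau>"
      by (rule order_trans[OF abs_triangle_ineq add_mono])
        (use noise r_le \<open>k < p\<close> in \<open>auto simp: z_def\<close>)
    then show "\<bar>z k + r k\<bar> \<le> (1 + \<alpha> / 2) * \<tau>" by (simp add: algebra_simps)
  qed
  have "b $ k \<noteq> 0 \<longleftrightarrow> k \<in> S" if "k < p" for k
  proof (cases "k \<in> S")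
    case True
    then show ?thesis using close[OF True] signal[OF True] by (auto simp: \<Delta>_def)
  next
    case False
    then show ?thesis using zero[of k] off[of k] that by (auto simp: \<Delta>_def)
  qed
  then show ?thesis using b S unfolding S_def[symmetric] by (auto simp: supp_def)
qed

section \<open>Sub-Gaussian tails\<close>

text \<open>
  A weighted sum of independent sub-Gaussian variables is sub-Gaussian with variance proxy
  \<open>c\<^sup>2 * v\<close>, because independence turns its moment generating function into a product; Chernoff's
  bound then gives the tail.\<close>

lemma (in prob_space) indep_subgaussian_sum_tail:
  fixes W :: "'i \<Rightarrow> 'a \<Rightarrow> real" and a :: "'i \<Rightarrow> real"
  assumes I: "finite I" and ind: "indep_vars (\<lambda>_. borel) W I"
    and sub: "\<And>i. i \<in> I \<Longrightarrow> subgaussian M (W i) c"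
    and a: "(\<Sum>i\<in>I. (a i)\<^sup>2) \<le> v" and pos: "0 < v" "0 < c" "0 < \<epsilon>"
  shows "prob {\<omega> \<in> space M. \<epsilon> \<le> (\<Sum>i\<in>I. a i * W i \<omega>)} \<le> exp (- \<epsilon>\<^sup>2 / (2 * c\<^sup>2 * v))"
proof -
  \<comment> \<open>The minimizer of the exponent \<open>- t * \<epsilon> + c\<^sup>2 * t\<^sup>2 / 2 * v\<close> of the Chernoff bound.\<close>
  define t where "t = \<epsilon> / (c\<^sup>2 * v)"
  have "t > 0" using pos by (simp add: t_def)
  have prod: "exp (t * (\<Sum>i\<in>I. a i * W i \<omega>)) = (\<Prod>i\<in>I. exp (t * a i * W i \<omega>))" for \<omega>
    by (simp add: exp_sum[OF I] sum_distrib_left mult.assoc)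
  have ind': "indep_vars (\<lambda>_. borel) (\<lambda>i \<omega>. exp (t * a i * W i \<omega>)) I"
    by (rule indep_vars_compose2[OF ind, where Y = "\<lambda>i x. exp (t * a i * x)"]) simp
  have int: "i \<in> I \<Longrightarrow> integrable M (\<lambda>\<omega>. exp (t * a i * W i \<omega>))" for i
    using sub by (simp add: subgaussian_def)
  have "(\<integral>\<omega>. exp (t * (\<Sum>i\<in>I. a i * W i \<omega>)) \<partial>M) = (\<Prod>i\<in>I. \<integral>\<omega>. exp (t * a i * W i \<omega>) \<partial>M)"
    unfolding prod by (rule indep_vars_lebesgue_integral[OF I ind' int])
  also have "\<dots> \<le> (\<Prod>i\<in>I. exp (c\<^sup>2 * (t * a i)\<^sup>2 / 2))"
    by (rule prod_mono) (use sub in \<open>auto simp: subgaussian_def\<close>)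
  also have "\<dots> = exp (c\<^sup>2 * t\<^sup>2 / 2 * (\<Sum>i\<in>I. (a i)\<^sup>2))"
    by (simp add: exp_sum[OF I, symmetric] sum_distrib_left power_mult_distrib mult_ac)
  also have "\<dots> \<le> exp (c\<^sup>2 * t\<^sup>2 / 2 * v)" using a by (simp add: mult_left_mono)
  finally have mgf: "(\<integral>\<omega>. exp (t * (\<Sum>i\<in>I. a i * W i \<omega>)) \<partial>M) \<le> exp (c\<^sup>2 * t\<^sup>2 / 2 * v)" .
  have "integrable M (\<lambda>\<omega>. exp (t * (\<Sum>i\<in>I. a i * W i \<omega>)))"
    unfolding prod by (rule indep_vars_integrable[OF I ind' int])
  then have "set_integrable M (space M) (\<lambda>\<omega>. exp (t * (\<Sum>i\<in>I. a i * W i \<omega>)))"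
    unfolding set_integrable_def by (rule integrable_mult_indicator[OF sets.top])
  moreover have "(\<integral>\<omega>\<in>space M. exp (t * (\<Sum>i\<in>I. a i * W i \<omega>)) \<partial>M)
      = (\<integral>\<omega>. exp (t * (\<Sum>i\<in>I. a i * W i \<omega>)) \<partial>M)"
    unfolding set_lebesgue_integral_def by (rule Bochner_Integration.integral_cong) auto
  ultimately have "prob {\<omega> \<in> space M. \<epsilon> \<le> (\<Sum>i\<in>I. a i * W i \<omega>)}
      \<le> exp (- t * \<epsilon>) * (\<integral>\<omega>. exp (t * (\<Sum>i\<in>I. a i * W i \<omega>)) \<partial>M)"
    using Chernoff_ineq_ge[OF \<open>t > 0\<close>, of "space M" "\<lambda>\<omega>. \<Sum>i\<in>I. a i * W i \<omega>" \<epsilon>] by simp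
  also have "\<dots> \<le> exp (- t * \<epsilon>) * exp (c\<^sup>2 * t\<^sup>2 / 2 * v)" by (rule mult_left_mono[OF mgf]) simp
  also have "\<dots> = exp (- t * \<epsilon> + c\<^sup>2 * t\<^sup>2 / 2 * v)" by (rule exp_add[symmetric])
  also have "- t * \<epsilon> + c\<^sup>2 * t\<^sup>2 / 2 * v = - \<epsilon>\<^sup>2 / (2 * c\<^sup>2 * v)"
    using pos by (simp add: t_def field_simps power2_eq_square)
  finally show ?thesis .
qed

lemma (in prob_space) indep_subgaussian_sum_tail_abs:
  fixes W :: "'i \<Rightarrow> 'a \<Rightarrow> real" and a :: "'i \<Rightarrow> real"
  assumes I: "finite I" and ind: "indep_vars (\<lambda>_. borel) W I"
    and sub: "\<And>i. i \<in> I \<Longrightarrow> subgaussian M (W i) c"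
    and a: "(\<Sum>i\<in>I. (a i)\<^sup>2) \<le> v" and pos: "0 < v" "0 < c" "0 < \<epsilon>"
  shows "prob {\<omega> \<in> space M. \<epsilon> \<le> \<bar>\<Sum>i\<in>I. a i * W i \<omega>\<bar>} \<le> 2 * exp (- \<epsilon>\<^sup>2 / (2 * c\<^sup>2 * v))"
proof -
  let ?E = "\<lambda>a. {\<omega> \<in> space M. \<epsilon> \<le> (\<Sum>i\<in>I. a i * W i \<omega>)}"
  have meas: "W i \<in> borel_measurable M" if "i \<in> I" for i
    using sub[OF that] by (auto simp: subgaussian_def)
  have ev: "?E a \<in> events" for a using meas by measurable
  have "{\<omega> \<in> space M. \<epsilon> \<le> \<bar>\<Sum>i\<in>I. a i * W i \<omega>\<bar>} = ?E a \<union> ?E (\<lambda>i. - a i)"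
    by (auto simp: sum_negf abs_if split: if_splits)
  then have "prob {\<omega> \<in> space M. \<epsilon> \<le> \<bar>\<Sum>i\<in>I. a i * W i \<omega>\<bar>} \<le> prob (?E a) + prob (?E (\<lambda>i. - a i))"
    using measure_Un_le[OF ev ev, of a "\<lambda>i. - a i"] by (simp only:)
  also have "\<dots> \<le> exp (- \<epsilon>\<^sup>2 / (2 * c\<^sup>2 * v)) + exp (- \<epsilon>\<^sup>2 / (2 * c\<^sup>2 * v))"
    by (intro add_mono indep_subgaussian_sum_tail[OF I ind sub _ pos]) (use a in auto)
  finally show ?thesis by simp
qed

section \<open>Consistency of the support\<close>

text \<open>
  With \<open>q n = sqrt (ln p / n) / \<tau>\<close>, the exponent equals \<open>(K / q\<^sup>2) * ln p\<close>.  Once \<open>K / q\<^sup>2 \<ge> 2\<close>, half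
  of it absorbs the factor \<open>p\<close>; the other half is at least \<open>(K / q\<^sup>2) / 2 * ln 2\<close>, which is where
  \<open>p \<ge> 2\<close> enters and which makes the bound work for bounded \<open>p\<close> too, and \<open>exp (- y) \<le> 1 / y\<close> leaves a bound
  proportional to \<open>q\<^sup>2\<close>.\<close>

lemma union_bound_rate_tendsto_0:
  fixes p :: "nat \<Rightarrow> nat" and \<tau> :: "nat \<Rightarrow> real"
  assumes p: "\<And>n. n \<ge> 1 \<Longrightarrow> p n \<ge> 2" and \<tau>: "\<And>n. n \<ge> 1 \<Longrightarrow> \<tau> n > 0" and K: "0 < K"
    and rate: "(\<lambda>n. sqrt (ln (real (p n)) / real n) / \<tau> n) \<longlonglongrightarrow> 0"
  shows "(\<lambda>n. real (p n) * exp (- (K * (real n * (\<tau> n)\<^sup>2)))) \<longlonglongrightarrow> 0"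
proof -
  define q where "q n = sqrt (ln (real (p n)) / real n) / \<tau> n" for n
  have q0: "(\<lambda>n. (q n)\<^sup>2) \<longlonglongrightarrow> 0"
    using tendsto_power[OF rate, of 2] by (simp add: q_def)
  have bound: "real (p n) * exp (- (K * (real n * (\<tau> n)\<^sup>2))) \<le> 2 / (K * ln 2) * (q n)\<^sup>2"
    if n: "n \<ge> 1" and small: "(q n)\<^sup>2 < K / 2" for n
  proof -
    have ln_p: "ln 2 \<le> ln (real (p n))" using p[OF n] by simp
    have "0 < ln (real (p n))" using ln_p ln_gt_zero[of "2::real"] by linarith
    then have q_pos: "0 < q n" using \<tau>[OF n] n by (simp add: q_def)
    have "(q n)\<^sup>2 * (real n * (\<tau> n)\<^sup>2) = ln (real (p n))"
      using \<open>0 < ln (real (p n))\<close> \<tau>[OF n] n by (simp add: q_def power_divide)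
    then have n_\<tau>: "real n * (\<tau> n)\<^sup>2 = ln (real (p n)) / (q n)\<^sup>2"
      using q_pos by (simp add: field_simps)
    define x where "x = K / (q n)\<^sup>2"
    have x: "2 \<le> x" "0 < x" using small q_pos K by (simp_all add: x_def field_simps)
    have "real (p n) * exp (- (K * (real n * (\<tau> n)\<^sup>2)))
        = exp (ln (real (p n)) + - (K * (real n * (\<tau> n)\<^sup>2)))"
      using p[OF n] by (subst exp_add) simp
    also have "\<dots> = exp (- ((x - 1) * ln (real (p n))))"
      unfolding n_\<tau> x_def by (simp add: algebra_simps)
    also have "\<dots> \<le> exp (- (x / 2 * ln 2))"
    proof -
      have "x / 2 * ln 2 \<le> (x - 1) * ln (real (p n))"
        by (rule mult_mono) (use x ln_p in auto)
      then show ?thesis by simp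
    qed
    also have "\<dots> \<le> 1 / (x / 2 * ln 2)"
    proof -
      have y: "0 < x / 2 * ln 2" using x by simp
      have "x / 2 * ln 2 \<le> exp (x / 2 * ln 2)" using exp_ge_add_one_self[of "x / 2 * ln 2"] by linarith
      then show ?thesis using y unfolding exp_minus inverse_eq_divide by (intro divide_left_mono) auto
    qed
    also have "\<dots> = 2 / (K * ln 2) * (q n)\<^sup>2" using K q_pos by (simp add: x_def field_simps)
    finally show ?thesis .
  qed
  have "\<forall>\<^sub>F n in sequentially. (q n)\<^sup>2 < K / 2"
    using order_tendstoD(2)[OF q0, of "K / 2"] K by simp
  then have upper: "\<forall>\<^sub>F n in sequentially.
      real (p n) * exp (- (K * (real n * (\<tau> n)\<^sup>2))) \<le> 2 / (K * ln 2) * (q n)\<^sup>2"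
    using eventually_ge_at_top[of 1] by eventually_elim (rule bound)
  have nonneg: "\<forall>\<^sub>F n in sequentially. 0 \<le> real (p n) * exp (- (K * (real n * (\<tau> n)\<^sup>2)))"
    by simp
  have upper_limit: "(\<lambda>n. 2 / (K * ln 2) * (q n)\<^sup>2) \<longlonglongrightarrow> 0"
    by (rule tendsto_mult_right_zero[OF q0])
  show ?thesis by (rule tendsto_sandwich[OF nonneg upper tendsto_const upper_limit])
qed

theorem corollary6p1:
  fixes M :: "nat \<Rightarrow> 'a measure"
    and p s :: "nat \<Rightarrow> nat"
    and X :: "nat \<Rightarrow> real Matrix.mat"
    and \<beta>star :: "nat \<Rightarrow> real Matrix.vec"
    and W Y :: "nat \<Rightarrow> nat \<Rightarrow> 'a \<Rightarrow> real"
    and \<beta>hat :: "nat \<Rightarrow> 'a \<Rightarrow> real Matrix.vec"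
    and \<tau> lmin \<alpha> :: "nat \<Rightarrow> real"
    and c :: real
  assumes "\<forall>n\<ge>1. prob_space (M n)"
    and "\<forall>n\<ge>1. p n \<ge> 2"
    and "\<forall>n\<ge>1. \<beta>star n \<in> carrier_vec (p n) \<and> card (supp (\<beta>star n)) \<le> s n"
    and "\<forall>n\<ge>1. X n \<in> carrier_mat n (p n)"
    and "\<forall>n\<ge>1. \<forall>j<p n. L2_set (\<lambda>i. X n $$ (i, j)) {..<n} \<le> sqrt (real n)"
    and "c > 0"
    and "\<forall>n\<ge>1. prob_space.indep_vars (M n) (\<lambda>_. borel) (W n) {..<n}"
    and "\<forall>n\<ge>1. \<forall>i<n. subgaussian (M n) (W n i) c"
    and "\<forall>n\<ge>1. \<forall>i<n. \<forall>\<omega>\<in>space (M n).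
           Y n i \<omega> = scalar_prod (Matrix.row (X n) i) (\<beta>star n) + W n i \<omega>"
    and "\<forall>n\<ge>1. \<tau> n > 0"
    and "\<forall>n\<ge>1. \<forall>\<omega>\<in>space (M n).
           is_arg_min (\<lambda>\<beta>. lsq_loss (X n) (\<lambda>i. Y n i \<omega>) \<beta> + \<tau> n * l1_norm \<beta>)
             (\<lambda>\<beta>. \<beta> \<in> carrier_vec (p n)) (\<beta>hat n \<omega>)"
    and "\<forall>n\<ge>1. \<forall>k<p n. (\<lambda>\<omega>. \<beta>hat n \<omega> $ k) \<in> borel_measurable (M n)"
    and "\<forall>n\<ge>1. 0 < lmin n \<and> 0 < \<alpha> n \<and> \<alpha> n \<le> 1"
    and "\<exists>\<delta>>0. \<forall>n\<ge>1. \<delta> \<le> lmin n \<and> \<delta> \<le> \<alpha> n"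
    and "\<forall>n\<ge>1. \<forall>\<omega>\<in>space (M n).
           let H = hessian (lsq_loss (X n) (\<lambda>i. Y n i \<omega>)) (\<beta>star n); S = supp (\<beta>star n)
           in psd_le (lmin n \<cdot>\<^sub>m 1\<^sub>m (card S)) (submatrix H S S)"
    and "\<forall>n\<ge>1. \<forall>\<omega>\<in>space (M n).
           let H = hessian (lsq_loss (X n) (\<lambda>i. Y n i \<omega>)) (\<beta>star n); S = supp (\<beta>star n)
           in linf_op_norm (submatrix H ({..<p n} - S) S * the (mat_inverse (submatrix H S S)))
                < 1 - \<alpha> n"
    and "\<forall>n\<ge>1. \<forall>k\<in>supp (\<beta>star n).
           \<bar>\<beta>star n $ k\<bar> > (\<alpha> n + 4) / lmin n * sqrt (real (s n)) * \<tau> n"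
    and "(\<lambda>n. real (s n) * ln (real (p n)) / real n) \<longlonglongrightarrow> 0"
    and "(\<lambda>n. sqrt (ln (real (p n)) / real n) / \<tau> n) \<longlonglongrightarrow> 0"
  shows "(\<lambda>n. measure (M n) {\<omega> \<in> space (M n). supp (\<beta>hat n \<omega>) \<noteq> supp (\<beta>star n)})
           \<longlonglongrightarrow> 0"
proof -
  obtain \<delta> where \<delta>: "\<delta> > 0" "\<And>n. n \<ge> 1 \<Longrightarrow> \<delta> \<le> \<alpha> n" using assms(14) by blast
  \<comment> \<open>The exponent \<open>\<epsilon>\<^sup>2 / (2 * c\<^sup>2 * v)\<close> of the tail bound, for \<open>\<epsilon> = \<delta> * \<tau> / 2\<close> and \<open>v = 1 / n\<close>, per unit
    of \<open>n * \<tau>\<^sup>2\<close>.\<close>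
  define K where "K = \<delta>\<^sup>2 / (8 * c\<^sup>2)"
  have "K > 0" using \<delta>(1) assms(6) by (simp add: K_def)
  have bound: "measure (M n) {\<omega> \<in> space (M n). supp (\<beta>hat n \<omega>) \<noteq> supp (\<beta>star n)}
      \<le> 2 * (real (p n) * exp (- (K * (real n * (\<tau> n)\<^sup>2))))" if n: "n \<ge> 1" for n
  proof -
    interpret prob_space "M n" using assms(1) n by blast
    have X: "X n \<in> carrier_mat n (p n)" and bs: "\<beta>star n \<in> carrier_vec (p n)"
      and s: "card (supp (\<beta>star n)) \<le> s n" and \<tau>: "0 < \<tau> n"
      and pos: "0 < lmin n" "0 < \<alpha> n"
      using assms(3,4,10,13) n by auto
    \<comment> \<open>The tolerance \<open>\<alpha> \<tau> / 2\<close> for the noise, with \<open>\<alpha>\<close> replaced by its uniform lower bound so that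
      the exponent \<open>K\<close> does not depend on \<open>n\<close>.\<close>
    define \<epsilon> where "\<epsilon> = \<delta> * \<tau> n / 2"
    define noise where "noise k \<omega> = (\<Sum>i<n. (X n $$ (i, k) / real n) * W n i \<omega>)" for k \<omega>
    define bad where "bad k = {\<omega> \<in> space (M n). \<epsilon> \<le> \<bar>noise k \<omega>\<bar>}" for k
    have W_meas: "W n i \<in> borel_measurable (M n)" if "i < n" for i
    proof -
      have "subgaussian (M n) (W n i) c" using assms(8) n that by blast
      then show ?thesis by (simp add: subgaussian_def borel_measurable_integrable)
    qed
    have bad_event: "bad k \<in> events" for k
      unfolding bad_def noise_def using W_meas by measurable
    have "{\<omega> \<in> space (M n). supp (\<beta>hat n \<omega>) \<noteq> supp (\<beta>star n)} \<subseteq> (\<Union>k<p n. bad k)"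
    proof (rule subsetI, rule ccontr)
      fix \<omega> assume \<omega>: "\<omega> \<in> {\<omega> \<in> space (M n). supp (\<beta>hat n \<omega>) \<noteq> supp (\<beta>star n)}"
        and good: "\<omega> \<notin> (\<Union>k<p n. bad k)"
      then have sp: "\<omega> \<in> space (M n)" by simp
      have "supp (\<beta>hat n \<omega>) = supp (\<beta>star n)"
      proof (rule lasso_support_recovery[OF X bs, where y = "\<lambda>i. Y n i \<omega>" and w = "\<lambda>i. W n i \<omega>"])
        show "Y n i \<omega> = scalar_prod (Matrix.row (X n) i) (\<beta>star n) + W n i \<omega>" if "i < n" for i
          using assms(9) n sp that by blast
        show "is_arg_min (\<lambda>\<beta>. lsq_loss (X n) (\<lambda>i. Y n i \<omega>) \<beta> + \<tau> n * l1_norm \<beta>)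
            (\<lambda>\<beta>. \<beta> \<in> carrier_vec (p n)) (\<beta>hat n \<omega>)"
          using assms(11) n sp by blast
        show "psd_le (lmin n \<cdot>\<^sub>m 1\<^sub>m (card (supp (\<beta>star n))))
            (submatrix (hessian (lsq_loss (X n) (\<lambda>i. Y n i \<omega>)) (\<beta>star n))
              (supp (\<beta>star n)) (supp (\<beta>star n)))"
          using assms(15) n sp unfolding Let_def by blast
        show "linf_op_norm (submatrix (hessian (lsq_loss (X n) (\<lambda>i. Y n i \<omega>)) (\<beta>star n))
              ({..<p n} - supp (\<beta>star n)) (supp (\<beta>star n))
            * the (mat_inverse (submatrix (hessian (lsq_loss (X n) (\<lambda>i. Y n i \<omega>)) (\<beta>star n))
              (supp (\<beta>star n)) (supp (\<beta>star n))))) < 1 - \<alpha> n"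
          using assms(16) n sp unfolding Let_def by blast
        show "(1 + \<alpha> n / 2) * \<tau> n * sqrt (card (supp (\<beta>star n))) / lmin n < \<bar>\<beta>star n $ k\<bar>"
          if "k \<in> supp (\<beta>star n)" for k
        proof -
          have "(1 + \<alpha> n / 2) * \<tau> n * sqrt (card (supp (\<beta>star n)))
              \<le> (\<alpha> n + 4) * \<tau> n * sqrt (real (s n))"
            by (intro mult_mono) (use pos \<tau> s in auto)
          then have "(1 + \<alpha> n / 2) * \<tau> n * sqrt (card (supp (\<beta>star n))) / lmin n
              \<le> (\<alpha> n + 4) * \<tau> n * sqrt (real (s n)) / lmin n"
            by (rule divide_right_mono) (use pos in simp)
          also have "\<dots> = (\<alpha> n + 4) / lmin n * sqrt (real (s n)) * \<tau> n" by simp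
          also have "\<dots> < \<bar>\<beta>star n $ k\<bar>" using assms(17) n that by blast
          finally show ?thesis .
        qed
        show "\<bar>1 / real n * (\<Sum>i<n. X n $$ (i, k) * W n i \<omega>)\<bar> \<le> \<alpha> n * \<tau> n / 2" if "k < p n" for k
        proof -
          have "\<bar>noise k \<omega>\<bar> < \<epsilon>" using good sp that by (auto simp: bad_def not_le)
          moreover have "noise k \<omega> = 1 / real n * (\<Sum>i<n. X n $$ (i, k) * W n i \<omega>)"
            by (simp add: noise_def sum_distrib_left)
          moreover have "\<epsilon> \<le> \<alpha> n * \<tau> n / 2"
            using \<delta>(2)[OF n] \<tau> by (simp add: \<epsilon>_def mult_right_mono)
          ultimately show ?thesis by linarith
        qed
      qed (use \<tau> pos in auto)
      with \<omega> show False by simp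
    qed
    then have "prob {\<omega> \<in> space (M n). supp (\<beta>hat n \<omega>) \<noteq> supp (\<beta>star n)} \<le> prob (\<Union>k<p n. bad k)"
      by (rule finite_measure_mono) (use bad_event in auto)
    also have "\<dots> \<le> (\<Sum>k<p n. prob (bad k))"
      by (rule measure_subadditive_finite) (use bad_event in auto)
    also have "\<dots> \<le> (\<Sum>k<p n. 2 * exp (- (K * (real n * (\<tau> n)\<^sup>2))))"
    proof (rule sum_mono)
      fix k assume k: "k \<in> {..<p n}"
      have "(L2_set (\<lambda>i. X n $$ (i, k)) {..<n})\<^sup>2 \<le> (sqrt (real n))\<^sup>2"
        by (rule power_mono) (use assms(5) n k in \<open>auto simp: L2_set_nonneg\<close>)
      then have "(\<Sum>i<n. (X n $$ (i, k))\<^sup>2) \<le> real n" by (simp add: L2_set_def sum_nonneg)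
      then have v: "(\<Sum>i<n. (X n $$ (i, k) / real n)\<^sup>2) \<le> 1 / real n"
        using n by (simp add: power_divide sum_divide_distrib[symmetric] field_simps power2_eq_square)
      have "prob (bad k) \<le> 2 * exp (- \<epsilon>\<^sup>2 / (2 * c\<^sup>2 * (1 / real n)))"
        unfolding bad_def noise_def
      proof (rule indep_subgaussian_sum_tail_abs[OF _ _ _ v])
        show "indep_vars (\<lambda>_. borel) (W n) {..<n}" using assms(7) n by blast
        show "subgaussian (M n) (W n i) c" if "i \<in> {..<n}" for i using assms(8) n that by blast
        show "0 < \<epsilon>" using \<delta>(1) \<tau> by (simp add: \<epsilon>_def)
      qed (use n assms(6) in auto)
      also have "- \<epsilon>\<^sup>2 / (2 * c\<^sup>2 * (1 / real n)) = - (K * (real n * (\<tau> n)\<^sup>2))"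
        using n assms(6) by (simp add: \<epsilon>_def K_def field_simps power2_eq_square)
      finally show "prob (bad k) \<le> 2 * exp (- (K * (real n * (\<tau> n)\<^sup>2)))" .
    qed
    finally show ?thesis by simp
  qed
  have "(\<lambda>n. real (p n) * exp (- (K * (real n * (\<tau> n)\<^sup>2)))) \<longlonglongrightarrow> 0"
    by (rule union_bound_rate_tendsto_0) (use assms(2,10,19) \<open>K > 0\<close> in auto)
  then have upper_limit: "(\<lambda>n. 2 * (real (p n) * exp (- (K * (real n * (\<tau> n)\<^sup>2))))) \<longlonglongrightarrow> 0"
    by (rule tendsto_mult_right_zero)
  have upper: "\<forall>\<^sub>F n in sequentially.
      measure (M n) {\<omega> \<in> space (M n). supp (\<beta>hat n \<omega>) \<noteq> supp (\<beta>star n)}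
      \<le> 2 * (real (p n) * exp (- (K * (real n * (\<tau> n)\<^sup>2))))"
    using eventually_ge_at_top[of 1] by eventually_elim (rule bound)
  have nonneg: "\<forall>\<^sub>F n in sequentially.
      0 \<le> measure (M n) {\<omega> \<in> space (M n). supp (\<beta>hat n \<omega>) \<noteq> supp (\<beta>star n)}"
    by simp
  show ?thesis by (rule tendsto_sandwich[OF nonneg upper tendsto_const upper_limit])
qed

end
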